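(* Given any set $X$, the free left-handed skew Boolean algebra ${}_{\mathcal L}\mathbf{SBA}_X$ on $X$ and the free right-handed skew Boolean algebra ${}_{\mathcal R}\mathbf{SBA}_X$ on $X$ have intersections. Given elements $x$ and $y$ in ${}_{\mathcal L}\mathbf{SBA}_X$, $x\cap y$ can be calculated in any subalgebra ${}_{\mathcal L}\mathbf{SBA}_Y$, where $Y$ is any finite subset of $X$ such that ${}_{\mathcal L}\mathbf{SBA}_Y$ contains both $x$ and $y$ (that is, the intersection of $x$ and $y$ in ${}_{\mathcal L}\mathbf{SBA}_Y$ is also their intersection in ${}_{\mathcal L}\mathbf{SBA}_X$). The analogous statement holds for ${}_{\mathcal R}\mathbf{SBA}_X$.
   Context: A skew lattice is an algebra $(S;\wedge,\vee)$ with associative binary operations satisfying $x\wedge(x\vee y)=x=(y\vee x)\wedge x$ and $x\vee(x\wedge y)=x=(y\wedge x)\vee x$. A skew Boolean algebra is an algebra $(S;\wedge,\vee,\setminus,0)$ such that $(S;\wedge,\vee)$ is a skew lattice satisfying $x\wedge(y\vee z)=(x\wedge y)\vee(x\wedge z)$ and $(x\vee y)\wedge z=(x\wedge z)\vee(y\wedge z)$, $0$ satisfies $0\wedge x=0=x\wedge 0$ and $0\vee x=x=x\vee 0$, and $(x\wedge y\wedge x)\vee(x\setminus y)=x$, $(x\wedge y\wedge x)\wedge(x\setminus y)=0=(x\setminus y)\wedge(x\wedge y\wedge x)$. It is left-handed if $x\wedge y\wedge x=x\wedge y$ and $x\vee y\vee x=y\vee x$ hold, right-handed if $x\wedge y\wedge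 x=y\wedge x$ and $x\vee y\vee x=x\vee y$ hold. Each of these classes is a variety, and free algebras are taken in the respective variety. The natural partial order is $x\ge y$ iff $x\wedge y=y=y\wedge x$. A skew lattice has intersections if every pair of elements $e,f$ has a greatest lower bound with respect to the natural partial order; this meet is denoted $e\cap f$ and called the intersection of $e$ and $f$. For $Y\subseteq X$, ${}_{\mathcal L}\mathbf{SBA}_Y$ is regarded as the subalgebra of ${}_{\mathcal L}\mathbf{SBA}_X$ generated by $Y$ (and likewise for ${}_{\mathcal R}\mathbf{SBA}$). *)

theory Defs
  imports "HOL-Algebra.Order"
begin

section \<open>Algebras of type \<open>(2, 2, 2, 0)\<close>, terms and identities\<close>

record 'a sba_alg = "'a partial_object" +
  sba_meet :: "'a \<Rightarrow> 'a \<Rightarrow> 'a"  (infixl \<open>\<sqinter>\<index>\<close> 70)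
  sba_join :: "'a \<Rightarrow> 'a \<Rightarrow> 'a"  (infixl \<open>\<squnion>\<index>\<close> 70)
  sba_diff :: "'a \<Rightarrow> 'a \<Rightarrow> 'a"  (infixl \<open>\<setminus>\<index>\<close> 70)
  sba_zero :: 'a  (\<open>\<zero>\<index>\<close>)

definition closed_under :: "('a, 'm) sba_alg_scheme \<Rightarrow> 'a set \<Rightarrow> bool" where
  "closed_under S B \<longleftrightarrow> \<zero>\<^bsub>S\<^esub> \<in> B \<and>
     (\<forall>x\<in>B. \<forall>y\<in>B. x \<sqinter>\<^bsub>S\<^esub> y \<in> B \<and> x \<squnion>\<^bsub>S\<^esub> y \<in> B \<and> x \<setminus>\<^bsub>S\<^esub> y \<in> B)"

definition subalgebra_gen :: "('a, 'm) sba_alg_scheme \<Rightarrow> 'a set \<Rightarrow> ('a, 'm) sba_alg_scheme" where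
  "subalgebra_gen S G =
     S\<lparr>carrier := \<Inter>{B. B \<subseteq> carrier S \<and> closed_under S B \<and> G \<subseteq> B}\<rparr>"

datatype (vars: 'v) sba_term =
    Var 'v
  | Zero  (\<open>\<^bold>0\<close>)
  | Meet "'v sba_term" "'v sba_term"  (infixl \<open>\<^bold>\<and>\<close> 70)
  | Join "'v sba_term" "'v sba_term"  (infixl \<open>\<^bold>\<or>\<close> 70)
  | Diff "'v sba_term" "'v sba_term"  (infixl \<open>\<^bold>\<setminus>\<close> 70)

primrec eval :: "('a, 'm) sba_alg_scheme \<Rightarrow> ('v \<Rightarrow> 'a) \<Rightarrow> 'v sba_term \<Rightarrow> 'a" where
  "eval S \<rho> (Var v) = \<rho> v"
| "eval S \<rho> \<^bold>0 = \<zero>\<^bsub>S\<^esub>"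
| "eval S \<rho> (s \<^bold>\<and> t) = eval S \<rho> s \<sqinter>\<^bsub>S\<^esub> eval S \<rho> t"
| "eval S \<rho> (s \<^bold>\<or> t) = eval S \<rho> s \<squnion>\<^bsub>S\<^esub> eval S \<rho> t"
| "eval S \<rho> (s \<^bold>\<setminus> t) = eval S \<rho> s \<setminus>\<^bsub>S\<^esub> eval S \<rho> t"

type_synonym identity = "nat sba_term \<times> nat sba_term"

definition in_variety :: "identity set \<Rightarrow> ('a, 'm) sba_alg_scheme \<Rightarrow> bool" where
  "in_variety E S \<longleftrightarrow> closed_under S (carrier S) \<and>
     (\<forall>(s, t)\<in>E. \<forall>\<rho>. range \<rho> \<subseteq> carrier S \<longrightarrow> eval S \<rho> s = eval S \<rho> t)"


section \<open>The varieties of left- and right-handed skew Boolean algebras\<close>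

definition skew_lattice_ids :: "identity set" where
  "skew_lattice_ids = (let x = Var 0; y = Var 1; z = Var 2 in
    {((x \<^bold>\<and> y) \<^bold>\<and> z, x \<^bold>\<and> (y \<^bold>\<and> z)),
     ((x \<^bold>\<or> y) \<^bold>\<or> z, x \<^bold>\<or> (y \<^bold>\<or> z)),
     (x \<^bold>\<and> (x \<^bold>\<or> y), x),
     ((y \<^bold>\<or> x) \<^bold>\<and> x, x),
     (x \<^bold>\<or> (x \<^bold>\<and> y), x),
     ((y \<^bold>\<and> x) \<^bold>\<or> x, x)})"

definition skew_boolean_ids :: "identity set" where
  "skew_boolean_ids = skew_lattice_ids \<union> (let x = Var 0; y = Var 1; z = Var 2 in
    {(x \<^bold>\<and> (y \<^bold>\<or> z), (x \<^bold>\<and> y) \<^bold>\<or> (x \<^bold>\<and> z)),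
     ((x \<^bold>\<or> y) \<^bold>\<and> z, (x \<^bold>\<and> z) \<^bold>\<or> (y \<^bold>\<and> z)),
     (\<^bold>0 \<^bold>\<and> x, \<^bold>0), (x \<^bold>\<and> \<^bold>0, \<^bold>0),
     (\<^bold>0 \<^bold>\<or> x, x), (x \<^bold>\<or> \<^bold>0, x),
     ((x \<^bold>\<and> y \<^bold>\<and> x) \<^bold>\<or> (x \<^bold>\<setminus> y), x),
     ((x \<^bold>\<and> y \<^bold>\<and> x) \<^bold>\<and> (x \<^bold>\<setminus> y), \<^bold>0),
     ((x \<^bold>\<setminus> y) \<^bold>\<and> (x \<^bold>\<and> y \<^bold>\<and> x), \<^bold>0)})"

definition left_handed_ids :: "identity set" where
  "left_handed_ids = (let x = Var 0; y = Var 1 in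
    {(x \<^bold>\<and> y \<^bold>\<and> x, x \<^bold>\<and> y), (x \<^bold>\<or> y \<^bold>\<or> x, y \<^bold>\<or> x)})"

definition right_handed_ids :: "identity set" where
  "right_handed_ids = (let x = Var 0; y = Var 1 in
    {(x \<^bold>\<and> y \<^bold>\<and> x, y \<^bold>\<and> x), (x \<^bold>\<or> y \<^bold>\<or> x, x \<^bold>\<or> y)})"

abbreviation "left_sba_ids \<equiv> skew_boolean_ids \<union> left_handed_ids"
abbreviation "right_sba_ids \<equiv> skew_boolean_ids \<union> right_handed_ids"


section \<open>Free algebras\<close>

definition term_alg :: "'v set \<Rightarrow> 'v sba_term sba_alg" where
  "term_alg X = \<lparr>carrier = {t. vars t \<subseteq> X}, sba_meet = Meet, sba_join = Join,
     sba_diff = Diff, sba_zero = Zero\<rparr>"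

text \<open>
  The least congruence on the term algebra over \<open>X\<close> containing all substitution instances of
  the identities \<open>E\<close>; substitution is evaluation in the term algebra.
\<close>

inductive_set term_cong :: "identity set \<Rightarrow> 'v set \<Rightarrow> ('v sba_term \<times> 'v sba_term) set"
  for E X where
  ax: "(s, t) \<in> E \<Longrightarrow> range \<sigma> \<subseteq> carrier (term_alg X) \<Longrightarrow>
         (eval (term_alg X) \<sigma> s, eval (term_alg X) \<sigma> t) \<in> term_cong E X"
| refl: "t \<in> carrier (term_alg X) \<Longrightarrow> (t, t) \<in> term_cong E X"
| sym: "(s, t) \<in> term_cong E X \<Longrightarrow> (t, s) \<in> term_cong E X"
| trans: "(s, t) \<in> term_cong E X \<Longrightarrow> (t, u) \<in> term_cong E X \<Longrightarrow> (s, u) \<in> term_cong E X"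
| meet: "(s, s') \<in> term_cong E X \<Longrightarrow> (t, t') \<in> term_cong E X \<Longrightarrow>
         (s \<^bold>\<and> t, s' \<^bold>\<and> t') \<in> term_cong E X"
| join: "(s, s') \<in> term_cong E X \<Longrightarrow> (t, t') \<in> term_cong E X \<Longrightarrow>
         (s \<^bold>\<or> t, s' \<^bold>\<or> t') \<in> term_cong E X"
| diff: "(s, s') \<in> term_cong E X \<Longrightarrow> (t, t') \<in> term_cong E X \<Longrightarrow>
         (s \<^bold>\<setminus> t, s' \<^bold>\<setminus> t') \<in> term_cong E X"

definition free_alg :: "identity set \<Rightarrow> 'v set \<Rightarrow> 'v sba_term set sba_alg" where
  "free_alg E X = \<lparr>carrier = carrier (term_alg X) // term_cong E X,
     sba_meet = (\<lambda>A B. \<Union>s\<in>A. \<Union>t\<in>B. term_cong E X `` {s \<^bold>\<and> t}),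
     sba_join = (\<lambda>A B. \<Union>s\<in>A. \<Union>t\<in>B. term_cong E X `` {s \<^bold>\<or> t}),
     sba_diff = (\<lambda>A B. \<Union>s\<in>A. \<Union>t\<in>B. term_cong E X `` {s \<^bold>\<setminus> t}),
     sba_zero = term_cong E X `` {\<^bold>0}\<rparr>"

definition free_gen :: "identity set \<Rightarrow> 'v set \<Rightarrow> 'v \<Rightarrow> 'v sba_term set" where
  "free_gen E X v = term_cong E X `` {Var v}"

definition left_SBA :: "'v set \<Rightarrow> 'v sba_term set sba_alg" where
  "left_SBA X = free_alg left_sba_ids X"

definition right_SBA :: "'v set \<Rightarrow> 'v sba_term set sba_alg" where
  "right_SBA X = free_alg right_sba_ids X"

text \<open>For \<open>Y \<subseteq> X\<close>, the free algebra on \<open>Y\<close> as a subalgebra of the free algebra on \<open>X\<close>.\<close>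

definition left_SBA_sub :: "'v set \<Rightarrow> 'v set \<Rightarrow> 'v sba_term set sba_alg" where
  "left_SBA_sub X Y = subalgebra_gen (left_SBA X) (free_gen left_sba_ids X ` Y)"

definition right_SBA_sub :: "'v set \<Rightarrow> 'v set \<Rightarrow> 'v sba_term set sba_alg" where
  "right_SBA_sub X Y = subalgebra_gen (right_SBA X) (free_gen right_sba_ids X ` Y)"


section \<open>Natural order and intersections\<close>

definition natural_order :: "('a, 'm) sba_alg_scheme \<Rightarrow> 'a gorder" where
  "natural_order S = \<lparr>carrier = carrier S, eq = (=),
     le = (\<lambda>y x. x \<sqinter>\<^bsub>S\<^esub> y = y \<and> y \<sqinter>\<^bsub>S\<^esub> x = y)\<rparr>"

definition is_intersection :: "('a, 'm) sba_alg_scheme \<Rightarrow> 'a \<Rightarrow> 'a \<Rightarrow> 'a \<Rightarrow> bool" where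
  "is_intersection S e f m \<longleftrightarrow> is_glb (natural_order S) m {e, f}"

definition has_intersections :: "('a, 'm) sba_alg_scheme \<Rightarrow> bool" where
  "has_intersections S \<longleftrightarrow> (\<forall>e\<in>carrier S. \<forall>f\<in>carrier S. \<exists>m. is_intersection S e f m)"


section \<open>The quotient is the free algebra of the variety\<close>

lemma term_alg_simps [simp]:
  "t \<in> carrier (term_alg X) \<longleftrightarrow> vars t \<subseteq> X"
  "sba_meet (term_alg X) = Meet" "sba_join (term_alg X) = Join"
  "sba_diff (term_alg X) = Diff" "sba_zero (term_alg X) = Zero"
  by (auto simp: term_alg_def)

lemma vars_eval_term_alg:
  "range \<sigma> \<subseteq> carrier (term_alg X) \<Longrightarrow> vars (eval (term_alg X) \<sigma> t) \<subseteq> X"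
  by (induction t) (auto simp: image_subset_iff)

lemma term_cong_vars:
  "(s, t) \<in> term_cong E X \<Longrightarrow> vars s \<subseteq> X \<and> vars t \<subseteq> X"
  by (induction rule: term_cong.induct) (auto dest: vars_eval_term_alg)

lemma equiv_term_cong: "equiv (carrier (term_alg X)) (term_cong E X)"
proof (rule equivI)
  show "term_cong E X \<subseteq> carrier (term_alg X) \<times> carrier (term_alg X)"
    by (auto dest: term_cong_vars)
  show "refl_on (carrier (term_alg X)) (term_cong E X)"
    by (rule refl_onI) (rule term_cong.refl)
  show "sym (term_cong E X)"
    by (rule symI) (rule term_cong.sym)
  show "trans (term_cong E X)"
    by (rule transI) (rule term_cong.trans)
qed

lemma free_alg_ops:
  assumes "vars s \<subseteq> X" "vars t \<subseteq> X"
  shows "term_cong E X `` {s} \<sqinter>\<^bsub>free_alg E X\<^esub> term_cong E X `` {t} = term_cong E X `` {s \<^bold>\<and> t}"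
    and "term_cong E X `` {s} \<squnion>\<^bsub>free_alg E X\<^esub> term_cong E X `` {t} = term_cong E X `` {s \<^bold>\<or> t}"
    and "term_cong E X `` {s} \<setminus>\<^bsub>free_alg E X\<^esub> term_cong E X `` {t} = term_cong E X `` {s \<^bold>\<setminus> t}"
proof -
  have *: "(\<Union>a\<in>term_cong E X `` {s}. \<Union>b\<in>term_cong E X `` {t}. term_cong E X `` {f a b})
          = term_cong E X `` {f s t}"
    if f: "\<And>a a' b b'. (a, a') \<in> term_cong E X \<Longrightarrow> (b, b') \<in> term_cong E X \<Longrightarrow>
              (f a b, f a' b') \<in> term_cong E X" for f
  proof -
    have "term_cong E X `` {f a b} = term_cong E X `` {f s t}"
      if "(s, a) \<in> term_cong E X" "(t, b) \<in> term_cong E X" for a b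
      using equiv_class_eq[OF equiv_term_cong f[OF that]] by simp
    moreover have "(s, s) \<in> term_cong E X" "(t, t) \<in> term_cong E X"
      using assms by (auto intro: term_cong.refl)
    ultimately show ?thesis by blast
  qed
  show "term_cong E X `` {s} \<sqinter>\<^bsub>free_alg E X\<^esub> term_cong E X `` {t} = term_cong E X `` {s \<^bold>\<and> t}"
    and "term_cong E X `` {s} \<squnion>\<^bsub>free_alg E X\<^esub> term_cong E X `` {t} = term_cong E X `` {s \<^bold>\<or> t}"
    and "term_cong E X `` {s} \<setminus>\<^bsub>free_alg E X\<^esub> term_cong E X `` {t} = term_cong E X `` {s \<^bold>\<setminus> t}"
    unfolding free_alg_def by (simp_all add: *[OF term_cong.meet] *[OF term_cong.join] *[OF term_cong.diff])
qed

lemma free_alg_carrier: "carrier (free_alg E X) = (\<lambda>t. term_cong E X `` {t}) ` {t. vars t \<subseteq> X}"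
  by (auto simp: free_alg_def quotient_def)

lemma free_alg_zero: "\<zero>\<^bsub>free_alg E X\<^esub> = term_cong E X `` {\<^bold>0}"
  by (simp add: free_alg_def)

lemma eval_free_alg:
  assumes "range \<sigma> \<subseteq> carrier (term_alg X)"
  shows "eval (free_alg E X) (\<lambda>v. term_cong E X `` {\<sigma> v}) t
         = term_cong E X `` {eval (term_alg X) \<sigma> t}"
  by (induction t) (simp_all add: free_alg_zero free_alg_ops vars_eval_term_alg[OF assms])

theorem free_alg_in_variety: "in_variety E (free_alg E X)"
  unfolding in_variety_def
proof (intro conjI ballI)
  show "closed_under (free_alg E X) (carrier (free_alg E X))"
    by (auto simp: closed_under_def free_alg_carrier free_alg_zero free_alg_ops)
next
  fix p assume p: "p \<in> E"
  obtain s t where st: "p = (s, t)" by fastforce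
  have "eval (free_alg E X) \<rho> s = eval (free_alg E X) \<rho> t"
    if \<rho>: "range \<rho> \<subseteq> carrier (free_alg E X)" for \<rho> :: "nat \<Rightarrow> 'a sba_term set"
  proof -
    have "\<forall>v. \<exists>u. vars u \<subseteq> X \<and> \<rho> v = term_cong E X `` {u}"
      using \<rho> unfolding free_alg_carrier by blast
    then obtain \<sigma> where \<sigma>: "\<And>v. vars (\<sigma> v) \<subseteq> X" and \<rho>_eq: "\<rho> = (\<lambda>v. term_cong E X `` {\<sigma> v})"
      by metis
    have r: "range \<sigma> \<subseteq> carrier (term_alg X)" using \<sigma> by auto
    have "(eval (term_alg X) \<sigma> s, eval (term_alg X) \<sigma> t) \<in> term_cong E X"
      using p st r by (intro term_cong.ax) auto
    then show ?thesis
      unfolding \<rho>_eq eval_free_alg[OF r] by (rule equiv_class_eq[OF equiv_term_cong])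
  qed
  then show "case p of (s, t) \<Rightarrow> \<forall>\<rho>. range \<rho> \<subseteq> carrier (free_alg E X) \<longrightarrow>
      eval (free_alg E X) \<rho> s = eval (free_alg E X) \<rho> t"
    by (simp add: st)
qed

definition sba_hom :: "('a, 'm) sba_alg_scheme \<Rightarrow> ('b, 'n) sba_alg_scheme \<Rightarrow> ('a \<Rightarrow> 'b) set" where
  "sba_hom S T = {h. h ` carrier S \<subseteq> carrier T \<and> h \<zero>\<^bsub>S\<^esub> = \<zero>\<^bsub>T\<^esub> \<and>
     (\<forall>x\<in>carrier S. \<forall>y\<in>carrier S. h (x \<sqinter>\<^bsub>S\<^esub> y) = h x \<sqinter>\<^bsub>T\<^esub> h y \<and>
        h (x \<squnion>\<^bsub>S\<^esub> y) = h x \<squnion>\<^bsub>T\<^esub> h y \<and> h (x \<setminus>\<^bsub>S\<^esub> y) = h x \<setminus>\<^bsub>T\<^esub> h y)}"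

lemma eval_closed:
  "closed_under S (carrier S) \<Longrightarrow> \<rho> ` vars t \<subseteq> carrier S \<Longrightarrow> eval S \<rho> t \<in> carrier S"
  by (induction t) (auto simp: closed_under_def)

lemma eval_subst: "eval S \<rho> (eval (term_alg X) \<sigma> t) = eval S (\<lambda>v. eval S \<rho> (\<sigma> v)) t"
  by (induction t) auto

lemma term_cong_sound:
  assumes S: "in_variety E S" and f: "f ` X \<subseteq> carrier S"
  shows "(s, t) \<in> term_cong E X \<Longrightarrow> eval S f s = eval S f t"
proof (induction rule: term_cong.induct)
  case (ax s t \<sigma>)
  have "eval S f (\<sigma> v) \<in> carrier S" for v
  proof (rule eval_closed)
    show "closed_under S (carrier S)" using S by (simp add: in_variety_def)
    have "vars (\<sigma> v) \<subseteq> X" using ax(2) by (auto simp: image_subset_iff)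
    then show "f ` vars (\<sigma> v) \<subseteq> carrier S" using f by blast
  qed
  then have "range (\<lambda>v. eval S f (\<sigma> v)) \<subseteq> carrier S" by auto
  then show ?case using S ax(1) by (auto simp: in_variety_def eval_subst)
qed auto

theorem free_alg_universal:
  assumes S: "in_variety E S" and f: "f ` X \<subseteq> carrier S"
  shows "\<exists>h\<in>sba_hom (free_alg E X) S. \<forall>v\<in>X. h (free_gen E X v) = f v"
proof -
  define h where "h A = eval S f (SOME t. t \<in> A)" for A
  have h: "h (term_cong E X `` {t}) = eval S f t" if "vars t \<subseteq> X" for t
  proof -
    have "t \<in> term_cong E X `` {t}" using that by (auto intro: term_cong.refl)
    then have "(t, SOME u. u \<in> term_cong E X `` {t}) \<in> term_cong E X" 
      using someI[of "\<lambda>u. u \<in> term_cong E X `` {t}"] by blast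
    from term_cong_sound[OF S f this] show ?thesis by (simp add: h_def)
  qed
  have c: "eval S f t \<in> carrier S" if "vars t \<subseteq> X" for t
    using that S f by (intro eval_closed) (auto simp: in_variety_def)
  have "h \<in> sba_hom (free_alg E X) S"
    by (auto simp: sba_hom_def free_alg_carrier free_alg_zero free_alg_ops h c)
  moreover have "\<forall>v\<in>X. h (free_gen E X v) = f v" by (simp add: free_gen_def h)
  ultimately show ?thesis by blast
qed

theorem free_alg_universal_unique:
  assumes "h \<in> sba_hom (free_alg E X) S" "k \<in> sba_hom (free_alg E X) S"
    and "\<And>v. v \<in> X \<Longrightarrow> h (free_gen E X v) = k (free_gen E X v)"
    and "A \<in> carrier (free_alg E X)"
  shows "h A = k A"
proof -
  have "h (term_cong E X `` {t}) = k (term_cong E X `` {t})" if "vars t \<subseteq> X" for t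
    using that
  proof (induction t)
    case (Var v)
    then show ?case using assms(3) by (simp add: free_gen_def)
  next
    case Zero
    then show ?case using assms(1,2) by (simp add: sba_hom_def free_alg_zero)
  next
    case (Meet s t)
    then show ?case using assms(1,2)
      by (simp add: sba_hom_def free_alg_carrier flip: free_alg_ops)
  next
    case (Join s t)
    then show ?case using assms(1,2)
      by (simp add: sba_hom_def free_alg_carrier flip: free_alg_ops)
  next
    case (Diff s t)
    then show ?case using assms(1,2)
      by (simp add: sba_hom_def free_alg_carrier flip: free_alg_ops)
  qed
  then show ?thesis using assms(4) by (auto simp: free_alg_carrier)
qed

end

theory Submission
  imports Defs
begin

text \<open>
  Free left-handed algebras are compared with the primitive left-handed algebra \<open>choice_alg\<close>, whose
  elements are \<open>None\<close> (the zero) and \<open>Some v\<close>. Its nonzero elements are all equivalent: a meet of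
  two of them is the left argument, their join the right argument, their difference zero. A set
  \<open>A\<close> of variables gives a valuation in it, \<open>v \<mapsto> Some v\<close> for \<open>v \<in> A\<close> and \<open>v \<mapsto> None\<close> otherwise,
  and hence every term \<open>t\<close> has a value \<open>choice A t\<close>, which is \<open>None\<close> or an element of \<open>A\<close> that
  occurs in \<open>t\<close>.

  The values \<open>choice A t\<close>, for all \<open>A\<close>, determine \<open>t\<close> as an element of the free left-handed algebra
  (\<open>eval_gen_eq_iff\<close>). Indeed, in a left-handed skew Boolean algebra both \<open>w \<mapsto> w \<sqinter> e\<close> and
  \<open>w \<mapsto> w \<setminus> e\<close> are endomorphisms (\<open>meet_hom\<close>, \<open>diff_hom\<close>), and every \<open>w\<close> is the join of its two
  images. Splitting in this way along the value of each variable that occurs leaves situations in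
  which the nonzero values of variables are equivalent to one another; there the evaluation of a
  term is exactly its evaluation in \<open>choice_alg\<close> (\<open>eval_decided\<close>).

  So the free algebra is an algebra of functions \<open>A \<mapsto> choice A t\<close> with pointwise operations, and
  \<open>s\<close> lies below \<open>t\<close> iff \<open>choice A s\<close> is \<open>None\<close> or equal to \<open>choice A t\<close> for all \<open>A\<close>. The
  intersection of \<open>s\<close> and \<open>t\<close> must be the function that keeps the common value where the two
  functions agree and is \<open>None\<close> elsewhere. This function is the value of a term, in which only
  variables of \<open>s\<close> and \<open>t\<close> occur (\<open>ex_intersection_term\<close>), so it already lies in every subalgebra
  generated by a set of variables that contains \<open>s\<close> and \<open>t\<close>. It is the greatest lower bound there
  and in the whole algebra, and greatest lower bounds are unique.

  For right-handed algebras, reverse the arguments of meet and join. This turns them into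
  left-handed ones and changes neither the natural order nor the subalgebras.
\<close>

section \<open>Skew Boolean algebras and their opposites\<close>

locale skew_boolean_algebra =
  fixes S :: "('a, 'm) sba_alg_scheme" (structure)
  assumes closed: "closed_under S (carrier S)"
    and meet_assoc: "\<lbrakk>x \<in> carrier S; y \<in> carrier S; z \<in> carrier S\<rbrakk> \<Longrightarrow> (x \<sqinter> y) \<sqinter> z = x \<sqinter> (y \<sqinter> z)"
    and join_assoc: "\<lbrakk>x \<in> carrier S; y \<in> carrier S; z \<in> carrier S\<rbrakk> \<Longrightarrow> (x \<squnion> y) \<squnion> z = x \<squnion> (y \<squnion> z)"
    and meet_join_absorb: "\<lbrakk>x \<in> carrier S; y \<in> carrier S\<rbrakk> \<Longrightarrow> x \<sqinter> (x \<squnion> y) = x"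
    and join_meet_absorb_right: "\<lbrakk>x \<in> carrier S; y \<in> carrier S\<rbrakk> \<Longrightarrow> (y \<squnion> x) \<sqinter> x = x"
    and join_meet_absorb: "\<lbrakk>x \<in> carrier S; y \<in> carrier S\<rbrakk> \<Longrightarrow> x \<squnion> (x \<sqinter> y) = x"
    and meet_join_absorb_right: "\<lbrakk>x \<in> carrier S; y \<in> carrier S\<rbrakk> \<Longrightarrow> (y \<sqinter> x) \<squnion> x = x"
    and meet_distrib_left: "\<lbrakk>x \<in> carrier S; y \<in> carrier S; z \<in> carrier S\<rbrakk> \<Longrightarrow>
      x \<sqinter> (y \<squnion> z) = (x \<sqinter> y) \<squnion> (x \<sqinter> z)"
    and meet_distrib_right: "\<lbrakk>x \<in> carrier S; y \<in> carrier S; z \<in> carrier S\<rbrakk> \<Longrightarrow>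
      (x \<squnion> y) \<sqinter> z = (x \<sqinter> z) \<squnion> (y \<sqinter> z)"
    and zero_meet: "x \<in> carrier S \<Longrightarrow> \<zero> \<sqinter> x = \<zero>"
    and meet_zero: "x \<in> carrier S \<Longrightarrow> x \<sqinter> \<zero> = \<zero>"
    and zero_join: "x \<in> carrier S \<Longrightarrow> \<zero> \<squnion> x = x"
    and join_zero: "x \<in> carrier S \<Longrightarrow> x \<squnion> \<zero> = x"
    and join_diff: "\<lbrakk>x \<in> carrier S; y \<in> carrier S\<rbrakk> \<Longrightarrow> (x \<sqinter> y \<sqinter> x) \<squnion> (x \<setminus> y) = x"
    and meet_diff: "\<lbrakk>x \<in> carrier S; y \<in> carrier S\<rbrakk> \<Longrightarrow> (x \<sqinter> y \<sqinter> x) \<sqinter> (x \<setminus> y) = \<zero>"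
    and diff_meet: "\<lbrakk>x \<in> carrier S; y \<in> carrier S\<rbrakk> \<Longrightarrow> (x \<setminus> y) \<sqinter> (x \<sqinter> y \<sqinter> x) = \<zero>"
begin

lemma zero_closed [simp, intro]: "\<zero> \<in> carrier S"
  using closed by (simp add: closed_under_def)

lemma ops_closed [simp, intro]:
  assumes "x \<in> carrier S" "y \<in> carrier S"
  shows "x \<sqinter> y \<in> carrier S" "x \<squnion> y \<in> carrier S" "x \<setminus> y \<in> carrier S"
  using closed assms by (simp_all add: closed_under_def)

lemma meet_idem: "x \<in> carrier S \<Longrightarrow> x \<sqinter> x = x"
  by (metis meet_join_absorb join_meet_absorb ops_closed(1))

text \<open>
  Both sides are the two expansions of \<open>(a \<squnion> b) \<sqinter> (b \<squnion> a)\<close>.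
\<close>

lemma orthogonal_join_commute:
  assumes "a \<in> carrier S" "b \<in> carrier S" "a \<sqinter> b = \<zero>" "b \<sqinter> a = \<zero>"
  shows "a \<squnion> b = b \<squnion> a"
proof -
  have "(a \<squnion> b) \<sqinter> (b \<squnion> a) = a \<squnion> b"
    using assms by (subst meet_distrib_right)
      (simp_all add: meet_distrib_left meet_idem zero_join join_zero)
  moreover have "(a \<squnion> b) \<sqinter> (b \<squnion> a) = b \<squnion> a"
    using assms by (subst meet_distrib_left)
      (simp_all add: meet_distrib_right meet_idem zero_join join_zero)
  ultimately show ?thesis by simp
qed

end

locale left_handed_sba = skew_boolean_algebra +
  assumes meet_left_handed: "\<lbrakk>x \<in> carrier S; y \<in> carrier S\<rbrakk> \<Longrightarrow> x \<sqinter> y \<sqinter> x = x \<sqinter> y"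
    and join_left_handed: "\<lbrakk>x \<in> carrier S; y \<in> carrier S\<rbrakk> \<Longrightarrow> x \<squnion> y \<squnion> x = y \<squnion> x"

locale right_handed_sba = skew_boolean_algebra +
  assumes meet_right_handed: "\<lbrakk>x \<in> carrier S; y \<in> carrier S\<rbrakk> \<Longrightarrow> x \<sqinter> y \<sqinter> x = y \<sqinter> x"
    and join_right_handed: "\<lbrakk>x \<in> carrier S; y \<in> carrier S\<rbrakk> \<Longrightarrow> x \<squnion> y \<squnion> x = x \<squnion> y"

definition valuation3 :: "'a \<Rightarrow> 'a \<Rightarrow> 'a \<Rightarrow> nat \<Rightarrow> 'a" where
  "valuation3 x y z = (\<lambda>n. if n = 0 then x else if n = 1 then y else z)"

lemma valuation3_simps [simp]:
  "valuation3 x y z 0 = x" "valuation3 x y z (Suc 0) = y" "valuation3 x y z 2 = z"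
  by (simp_all add: valuation3_def)

lemma in_variety_instance:
  assumes "in_variety E S" "(s, t) \<in> E" "x \<in> carrier S" "y \<in> carrier S" "z \<in> carrier S"
  shows "eval S (valuation3 x y z) s = eval S (valuation3 x y z) t"
proof -
  have "range (valuation3 x y z) \<subseteq> carrier S"
    using assms(3-5) by (auto simp: valuation3_def)
  then show ?thesis using assms(1,2) by (auto simp: in_variety_def)
qed

lemma in_variety_skew_boolean_iff:
  "in_variety skew_boolean_ids S \<longleftrightarrow> skew_boolean_algebra S"
proof
  assume V: "in_variety skew_boolean_ids S"
  have "\<forall>(s, t)\<in>skew_boolean_ids. eval S (valuation3 x y z) s = eval S (valuation3 x y z) t"
    if "x \<in> carrier S" "y \<in> carrier S" "z \<in> carrier S" for x y z
    using in_variety_instance[OF V _ that] by blast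
  note ids = this[unfolded skew_boolean_ids_def skew_lattice_ids_def Let_def, simplified]
  show "skew_boolean_algebra S"
  proof
    show "closed_under S (carrier S)" using V by (simp add: in_variety_def)
  qed (use ids in blast)+
next
  assume "skew_boolean_algebra S"
  then interpret skew_boolean_algebra S .
  show "in_variety skew_boolean_ids S"
    by (auto simp: in_variety_def closed skew_boolean_ids_def skew_lattice_ids_def Let_def)
      (rule meet_assoc join_assoc meet_join_absorb join_meet_absorb_right
        join_meet_absorb meet_join_absorb_right meet_distrib_left meet_distrib_right
        zero_meet meet_zero zero_join join_zero join_diff meet_diff diff_meet; auto)+
qed

lemma in_variety_Un: "in_variety (E \<union> F) S \<longleftrightarrow> in_variety E S \<and> in_variety F S"
  by (auto simp: in_variety_def)

lemma in_variety_left_iff: "in_variety left_sba_ids S \<longleftrightarrow> left_handed_sba S"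
proof -
  have "left_handed_sba_axioms S" if "in_variety left_handed_ids S"
  proof -
    have "\<forall>(s, t)\<in>left_handed_ids. eval S (valuation3 x y x) s = eval S (valuation3 x y x) t"
      if "x \<in> carrier S" "y \<in> carrier S" for x y
      using in_variety_instance[OF \<open>in_variety left_handed_ids S\<close> _ that that(1)] by blast
    note ids = this[unfolded left_handed_ids_def Let_def, simplified]
    show ?thesis by unfold_locales (use ids in blast)+
  qed
  moreover have "in_variety left_handed_ids S" if "left_handed_sba S"
  proof -
    interpret left_handed_sba S by fact
    show ?thesis
      by (auto simp: in_variety_def closed left_handed_ids_def Let_def range_subsetD
          meet_left_handed join_left_handed)
  qed
  ultimately show ?thesis
    by (auto simp: in_variety_Un in_variety_skew_boolean_iff left_handed_sba_def)
qed

lemma in_variety_right_iff: "in_variety right_sba_ids S \<longleftrightarrow> right_handed_sba S"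
proof -
  have "right_handed_sba_axioms S" if "in_variety right_handed_ids S"
  proof -
    have "\<forall>(s, t)\<in>right_handed_ids. eval S (valuation3 x y x) s = eval S (valuation3 x y x) t"
      if "x \<in> carrier S" "y \<in> carrier S" for x y
      using in_variety_instance[OF \<open>in_variety right_handed_ids S\<close> _ that that(1)] by blast
    note ids = this[unfolded right_handed_ids_def Let_def, simplified]
    show ?thesis by unfold_locales (use ids in blast)+
  qed
  moreover have "in_variety right_handed_ids S" if "right_handed_sba S"
  proof -
    interpret right_handed_sba S by fact
    show ?thesis
      by (auto simp: in_variety_def closed right_handed_ids_def Let_def range_subsetD
          meet_right_handed join_right_handed)
  qed
  ultimately show ?thesis
    by (auto simp: in_variety_Un in_variety_skew_boolean_iff right_handed_sba_def)
qed

definition opposite :: "('a, 'm) sba_alg_scheme \<Rightarrow> ('a, 'm) sba_alg_scheme" where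
  "opposite S = S\<lparr>sba_meet := \<lambda>x y. y \<sqinter>\<^bsub>S\<^esub> x, sba_join := \<lambda>x y. y \<squnion>\<^bsub>S\<^esub> x\<rparr>"

lemma opposite_simps [simp]:
  "carrier (opposite S) = carrier S" "\<zero>\<^bsub>opposite S\<^esub> = \<zero>\<^bsub>S\<^esub>"
  "x \<sqinter>\<^bsub>opposite S\<^esub> y = y \<sqinter>\<^bsub>S\<^esub> x" "x \<squnion>\<^bsub>opposite S\<^esub> y = y \<squnion>\<^bsub>S\<^esub> x"
  "x \<setminus>\<^bsub>opposite S\<^esub> y = x \<setminus>\<^bsub>S\<^esub> y"
  by (simp_all add: opposite_def)

lemma closed_under_opposite [simp]: "closed_under (opposite S) B \<longleftrightarrow> closed_under S B"
  by (auto simp: closed_under_def)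

lemma sba_hom_opposite: "sba_hom (opposite S) T = sba_hom S (opposite T)"
  unfolding sba_hom_def opposite_simps by blast

lemma subalgebra_gen_opposite: "subalgebra_gen (opposite S) G = opposite (subalgebra_gen S G)"
  unfolding subalgebra_gen_def closed_under_opposite opposite_simps by (simp add: opposite_def)

text \<open>
  Only the complement law \<open>(x \<sqinter> y \<sqinter> x) \<squnion> (x \<setminus> y) = x\<close> is not visibly invariant under reversal;
  it survives because its two joinands are orthogonal and hence commute.
\<close>

lemma skew_boolean_opposite:
  assumes "skew_boolean_algebra S"
  shows "skew_boolean_algebra (opposite S)"
proof -
  interpret skew_boolean_algebra S by fact
  have join_diff': "(x \<setminus>\<^bsub>S\<^esub> y) \<squnion>\<^bsub>S\<^esub> (x \<sqinter>\<^bsub>S\<^esub> (y \<sqinter>\<^bsub>S\<^esub> x)) = x"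
    if "x \<in> carrier S" "y \<in> carrier S" for x y
    using orthogonal_join_commute[of "x \<setminus>\<^bsub>S\<^esub> y" "x \<sqinter>\<^bsub>S\<^esub> y \<sqinter>\<^bsub>S\<^esub> x"] that
      meet_diff[OF that] diff_meet[OF that] join_diff[OF that] meet_assoc[OF that that(1)] by simp
  have orthogonal: "(x \<sqinter>\<^bsub>S\<^esub> (y \<sqinter>\<^bsub>S\<^esub> x)) \<sqinter>\<^bsub>S\<^esub> (x \<setminus>\<^bsub>S\<^esub> y) = \<zero>\<^bsub>S\<^esub>"
    "(x \<setminus>\<^bsub>S\<^esub> y) \<sqinter>\<^bsub>S\<^esub> (x \<sqinter>\<^bsub>S\<^esub> (y \<sqinter>\<^bsub>S\<^esub> x)) = \<zero>\<^bsub>S\<^esub>"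
    if "x \<in> carrier S" "y \<in> carrier S" for x y
    using meet_diff[OF that] diff_meet[OF that] meet_assoc[OF that that(1)] by simp_all
  show ?thesis
    by (unfold_locales; simp only: opposite_simps closed_under_opposite closed)
      (rule meet_assoc[symmetric] join_assoc[symmetric] meet_join_absorb join_meet_absorb_right
        join_meet_absorb meet_join_absorb_right meet_distrib_left meet_distrib_right
        zero_meet meet_zero zero_join join_zero join_diff' orthogonal; assumption)+
qed

lemma left_handed_opposite: "right_handed_sba S \<Longrightarrow> left_handed_sba (opposite S)"
  unfolding left_handed_sba_def right_handed_sba_def
  by (auto simp: skew_boolean_opposite left_handed_sba_axioms_def right_handed_sba_axioms_def
      skew_boolean_algebra.meet_assoc skew_boolean_algebra.join_assoc)

lemma right_handed_opposite: "left_handed_sba S \<Longrightarrow> right_handed_sba (opposite S)"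
  unfolding left_handed_sba_def right_handed_sba_def
  by (auto simp: skew_boolean_opposite left_handed_sba_axioms_def right_handed_sba_axioms_def
      skew_boolean_algebra.meet_assoc skew_boolean_algebra.join_assoc)


section \<open>Splitting a left-handed skew Boolean algebra along an element\<close>

lemma eval_hom:
  assumes h: "h \<in> sba_hom S T" and S: "closed_under S (carrier S)" and "\<rho> ` vars t \<subseteq> carrier S"
  shows "h (eval S \<rho> t) = eval T (\<lambda>v. h (\<rho> v)) t"
  using assms(3)
proof (induction t)
  case (Meet s t)
  then show ?case using h eval_closed[OF S, of \<rho> s] eval_closed[OF S, of \<rho> t]
    by (simp add: sba_hom_def image_Un)
next
  case (Join s t)
  then show ?case using h eval_closed[OF S, of \<rho> s] eval_closed[OF S, of \<rho> t]
    by (simp add: sba_hom_def image_Un)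
next
  case (Diff s t)
  then show ?case using h eval_closed[OF S, of \<rho> s] eval_closed[OF S, of \<rho> t]
    by (simp add: sba_hom_def image_Un)
qed (use h in \<open>simp_all add: sba_hom_def\<close>)

lemma eval_cong_vars: "(\<And>v. v \<in> vars t \<Longrightarrow> \<rho> v = \<rho>' v) \<Longrightarrow> eval S \<rho> t = eval S \<rho>' t"
  by (induction t) auto

context left_handed_sba
begin

lemma join_diff_left: "\<lbrakk>x \<in> carrier S; y \<in> carrier S\<rbrakk> \<Longrightarrow> (x \<sqinter> y) \<squnion> (x \<setminus> y) = x"
  and meet_diff_left: "\<lbrakk>x \<in> carrier S; y \<in> carrier S\<rbrakk> \<Longrightarrow> (x \<sqinter> y) \<sqinter> (x \<setminus> y) = \<zero>"
  and diff_meet_left: "\<lbrakk>x \<in> carrier S; y \<in> carrier S\<rbrakk> \<Longrightarrow> (x \<setminus> y) \<sqinter> (x \<sqinter> y) = \<zero>"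
  using join_diff meet_diff diff_meet by (simp_all add: meet_left_handed)

text \<open>
  Both \<open>z\<close> and \<open>w \<setminus> v\<close> complement \<open>w \<sqinter> v\<close> inside \<open>w\<close>. Expanding \<open>z \<sqinter> w\<close> with the first
  decomposition of \<open>w\<close> gives \<open>z\<close>, with the second \<open>z \<sqinter> (w \<setminus> v)\<close>; expanding \<open>w \<sqinter> (w \<setminus> v)\<close>
  similarly gives \<open>w \<setminus> v = z \<sqinter> (w \<setminus> v)\<close>. As a consequence, difference is determined by the other
  operations.
\<close>

lemma diff_unique:
  assumes c: "w \<in> carrier S" "v \<in> carrier S" "z \<in> carrier S"
    and z: "(w \<sqinter> v) \<squnion> z = w" "(w \<sqinter> v) \<sqinter> z = \<zero>" "z \<sqinter> (w \<sqinter> v) = \<zero>"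
  shows "w \<setminus> v = z"
proof -
  let ?a = "w \<sqinter> v" and ?d = "w \<setminus> v"
  have "z = z \<sqinter> (?a \<squnion> z)"
    using c z(3) by (simp add: meet_distrib_left meet_idem zero_join)
  also have "\<dots> = z \<sqinter> (?a \<squnion> ?d)" using c z join_diff_left by simp
  also have "\<dots> = z \<sqinter> ?d" using c z(3) by (simp add: meet_distrib_left zero_join)
  also have "\<dots> = (?a \<squnion> z) \<sqinter> ?d"
    using c by (simp add: meet_distrib_right meet_diff_left zero_join)
  also have "\<dots> = (?a \<squnion> ?d) \<sqinter> ?d" using c z join_diff_left by simp
  also have "\<dots> = ?d" using c by (simp add: join_meet_absorb_right)
  finally show ?thesis by simp
qed

lemma zero_diff: "v \<in> carrier S \<Longrightarrow> \<zero> \<setminus> v = \<zero>"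
  by (rule diff_unique) (simp_all add: zero_meet zero_join)

lemma diff_zero: "w \<in> carrier S \<Longrightarrow> w \<setminus> \<zero> = w"
  by (rule diff_unique) (simp_all add: zero_meet meet_zero zero_join)

lemma diff_eq_zero: "\<lbrakk>w \<in> carrier S; v \<in> carrier S; w \<sqinter> v = w\<rbrakk> \<Longrightarrow> w \<setminus> v = \<zero>"
  by (rule diff_unique) (simp_all add: zero_meet meet_zero join_zero)

lemma diff_meet_eq_zero:
  assumes "w \<in> carrier S" "e \<in> carrier S"
  shows "(w \<setminus> e) \<sqinter> e = \<zero>" "e \<sqinter> (w \<setminus> e) = \<zero>"
proof -
  have "(w \<setminus> e) \<sqinter> w = w \<setminus> e"
    using assms meet_distrib_left[of "w \<setminus> e" "w \<sqinter> e" "w \<setminus> e"]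
    by (simp add: join_diff_left diff_meet_left meet_idem zero_join)
  then show 1: "(w \<setminus> e) \<sqinter> e = \<zero>"
    using assms diff_meet_left[of w e] by (simp flip: meet_assoc)
  show "e \<sqinter> (w \<setminus> e) = \<zero>"
    using assms 1 meet_left_handed[of e "w \<setminus> e"] by (simp add: meet_assoc meet_zero)
qed

text \<open>
  For \<open>a, b\<close> below \<open>x\<close>, write \<open>x = a \<squnion> a'\<close> with \<open>a' = x \<setminus> a\<close>. Then
  \<open>b \<sqinter> a = (a \<sqinter> b \<sqinter> a) \<squnion> (a' \<sqinter> b \<sqinter> a)\<close>, where the second joinand is \<open>a' \<sqinter> b \<sqinter> a' \<sqinter> a = \<zero>\<close>.
  So elements below \<open>x\<close> commute, which is left normality.
\<close>

lemma meet_left_normal: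
  assumes c: "x \<in> carrier S" "y \<in> carrier S" "z \<in> carrier S"
  shows "x \<sqinter> y \<sqinter> z = x \<sqinter> z \<sqinter> y"
proof -
  define a b where "a = x \<sqinter> z" and "b = x \<sqinter> y"
  define a' where "a' = x \<setminus> a"
  have ab: "a \<in> carrier S" "b \<in> carrier S" "a' \<in> carrier S"
    using c by (simp_all add: a_def b_def a'_def)
  have xa: "x \<sqinter> a = a" and xb: "x \<sqinter> b = b"
    using c by (simp_all add: a_def b_def meet_idem flip: meet_assoc)
  have "a' \<sqinter> b \<sqinter> a = a' \<sqinter> b \<sqinter> a' \<sqinter> a"
    using ab by (simp add: meet_left_handed)
  also have "\<dots> = a' \<sqinter> b \<sqinter> (a' \<sqinter> a)" using ab by (simp add: meet_assoc)
  also have "\<dots> = \<zero>" using c ab by (simp add: a'_def diff_meet_eq_zero meet_zero)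
  finally have 0: "a' \<sqinter> b \<sqinter> a = \<zero>" .
  have "a \<squnion> a' = x" using join_diff_left[of x a] c ab xa by (simp add: a'_def)
  then have "b = (a \<squnion> a') \<sqinter> b" using xb by simp
  then have "b \<sqinter> a = ((a \<sqinter> b) \<squnion> (a' \<sqinter> b)) \<sqinter> a" using ab by (simp add: meet_distrib_right)
  also have "\<dots> = a \<sqinter> b \<sqinter> a" using ab 0 by (simp add: meet_distrib_right join_zero)
  also have "\<dots> = a \<sqinter> b" using ab by (simp add: meet_left_handed)
  finally have "b \<sqinter> a = a \<sqinter> b" .
  moreover have "b \<sqinter> a = x \<sqinter> y \<sqinter> z"
    using c by (simp add: a_def b_def meet_left_handed flip: meet_assoc)
  moreover have "a \<sqinter> b = x \<sqinter> z \<sqinter> y"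
    using c by (simp add: a_def b_def meet_left_handed flip: meet_assoc)
  ultimately show ?thesis by simp
qed

lemma endomorphismI:
  assumes h: "\<And>x. x \<in> carrier S \<Longrightarrow> h x \<in> carrier S" "h \<zero> = \<zero>"
    and meet: "\<And>x y. \<lbrakk>x \<in> carrier S; y \<in> carrier S\<rbrakk> \<Longrightarrow> h (x \<sqinter> y) = h x \<sqinter> h y"
    and join: "\<And>x y. \<lbrakk>x \<in> carrier S; y \<in> carrier S\<rbrakk> \<Longrightarrow> h (x \<squnion> y) = h x \<squnion> h y"
  shows "h \<in> sba_hom S S"
proof -
  have "h x \<setminus> h y = h (x \<setminus> y)" if "x \<in> carrier S" "y \<in> carrier S" for x y
    using that by (intro diff_unique)
      (simp_all add: h join_diff_left meet_diff_left diff_meet_left flip: meet join)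
  then show ?thesis using assms by (auto simp: sba_hom_def)
qed

text \<open>
  Meets are preserved since \<open>x \<sqinter> (e \<sqinter> y \<sqinter> e) = x \<sqinter> e \<sqinter> y = x \<sqinter> y \<sqinter> e\<close>, by left-handedness and left
  normality.
\<close>

lemma meet_hom:
  assumes e: "e \<in> carrier S"
  shows "(\<lambda>w. w \<sqinter> e) \<in> sba_hom S S"
proof (rule endomorphismI)
  fix x y assume xy: "x \<in> carrier S" "y \<in> carrier S"
  have "x \<sqinter> e \<sqinter> (y \<sqinter> e) = x \<sqinter> (e \<sqinter> y \<sqinter> e)" using xy e by (simp add: meet_assoc)
  also have "\<dots> = x \<sqinter> e \<sqinter> y" using xy e by (simp add: meet_left_handed meet_assoc)
  also have "\<dots> = x \<sqinter> y \<sqinter> e" using xy e by (simp add: meet_left_normal)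
  finally show "x \<sqinter> y \<sqinter> e = x \<sqinter> e \<sqinter> (y \<sqinter> e)" by simp
qed (use e in \<open>simp_all add: zero_meet meet_distrib_right\<close>)

text \<open>
  The images of \<open>w \<mapsto> w \<setminus> e\<close> and of \<open>w \<mapsto> w \<sqinter> e\<close> annihilate each other, so that in a product or
  join of decomposed elements \<open>(w \<sqinter> e) \<squnion> (w \<setminus> e)\<close> all mixed terms vanish or can be moved past
  each other. Uniqueness of complements then identifies the part outside \<open>e\<close>.
\<close>

lemma diff_hom:
  assumes e: "e \<in> carrier S"
  shows "(\<lambda>w. w \<setminus> e) \<in> sba_hom S S"
proof (rule endomorphismI)
  fix x y assume xy: "x \<in> carrier S" "y \<in> carrier S"
  let ?x = "x \<setminus> e" and ?y = "y \<setminus> e"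
  have xye: "x \<sqinter> y \<sqinter> e = x \<sqinter> e \<sqinter> y" using xy e by (simp add: meet_left_normal)
  have kill: "?x \<sqinter> u \<sqinter> e = \<zero>" "?y \<sqinter> u \<sqinter> e = \<zero>" if "u \<in> carrier S" for u
    using xy e that by (simp_all add: meet_left_normal[of _ u] diff_meet_eq_zero zero_meet)
  have kill': "u \<sqinter> e \<sqinter> ?x = \<zero>" "u \<sqinter> e \<sqinter> ?y = \<zero>" if "u \<in> carrier S" for u
    using xy e that by (simp_all add: meet_assoc diff_meet_eq_zero meet_zero)
  \<comment> \<open>It suffices to remove \<open>e\<close> from the left factor; the right factor then loses its part in
    \<open>e\<close> automatically.\<close>
  have "(x \<sqinter> y) \<setminus> e = ?x \<sqinter> y"
  proof (rule diff_unique)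
    have "(x \<sqinter> y \<sqinter> e) \<squnion> (?x \<sqinter> y) = ((x \<sqinter> e) \<squnion> ?x) \<sqinter> y"
      using xy e by (simp add: xye meet_distrib_right)
    then show "(x \<sqinter> y \<sqinter> e) \<squnion> (?x \<sqinter> y) = x \<sqinter> y" using xy e by (simp add: join_diff_left)
    show "x \<sqinter> y \<sqinter> e \<sqinter> (?x \<sqinter> y) = \<zero>"
      using xy e by (simp add: kill' zero_meet flip: meet_assoc)
    have "?x \<sqinter> y \<sqinter> (x \<sqinter> y \<sqinter> e) = ?x \<sqinter> (y \<sqinter> x \<sqinter> y) \<sqinter> e" using xy e by (simp add: meet_assoc)
    then show "?x \<sqinter> y \<sqinter> (x \<sqinter> y \<sqinter> e) = \<zero>" using xy e by (simp only: kill ops_closed)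
  qed (use xy e in simp_all)
  also have "\<dots> = ?x \<sqinter> ((y \<sqinter> e) \<squnion> ?y)" using xy e by (simp add: join_diff_left)
  also have "\<dots> = (?x \<sqinter> y \<sqinter> e) \<squnion> (?x \<sqinter> ?y)" using xy e by (simp add: meet_distrib_left meet_assoc)
  also have "\<dots> = ?x \<sqinter> ?y" using xy e by (simp add: kill zero_join)
  finally show "(x \<sqinter> y) \<setminus> e = ?x \<sqinter> ?y" .
  show "(x \<squnion> y) \<setminus> e = ?x \<squnion> ?y"
  proof (rule diff_unique)
    have "(y \<sqinter> e) \<squnion> ?x = ?x \<squnion> (y \<sqinter> e)"
      using xy e by (intro orthogonal_join_commute) (simp_all add: kill' kill flip: meet_assoc)
    then have "((x \<squnion> y) \<sqinter> e) \<squnion> (?x \<squnion> ?y) = ((x \<sqinter> e) \<squnion> ?x) \<squnion> ((y \<sqinter> e) \<squnion> ?y)"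
      using xy e by (simp add: meet_distrib_right join_assoc)
        (metis join_assoc ops_closed)
    then show "((x \<squnion> y) \<sqinter> e) \<squnion> (?x \<squnion> ?y) = x \<squnion> y" using xy e by (simp add: join_diff_left)
    show "(x \<squnion> y) \<sqinter> e \<sqinter> (?x \<squnion> ?y) = \<zero>"
      using xy e by (simp add: meet_distrib_left kill' zero_join)
    show "(?x \<squnion> ?y) \<sqinter> ((x \<squnion> y) \<sqinter> e) = \<zero>"
      using xy e kill[of "x \<squnion> y"] meet_distrib_right[of ?x ?y "(x \<squnion> y) \<sqinter> e"]
      by (simp add: zero_join meet_assoc)
  qed (use xy e in simp_all)
qed (use e in \<open>simp_all add: zero_diff\<close>)

end


section \<open>Evaluation in the algebra of choices\<close>

definition choice_alg :: "'v option sba_alg" where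
  "choice_alg = \<lparr>carrier = UNIV,
     sba_meet = (\<lambda>a b. if b = None then None else a),
     sba_join = (\<lambda>a b. if b = None then a else b),
     sba_diff = (\<lambda>a b. if b = None then a else None),
     sba_zero = None\<rparr>"

lemma choice_alg_simps [simp]:
  "carrier choice_alg = UNIV" "\<zero>\<^bsub>choice_alg\<^esub> = None"
  "a \<sqinter>\<^bsub>choice_alg\<^esub> b = (if b = None then None else a)"
  "a \<squnion>\<^bsub>choice_alg\<^esub> b = (if b = None then a else b)"
  "a \<setminus>\<^bsub>choice_alg\<^esub> b = (if b = None then a else None)"
  by (simp_all add: choice_alg_def)

lemma left_handed_choice_alg: "left_handed_sba choice_alg"
  by unfold_locales (auto simp: closed_under_def)

definition pick :: "'v set \<Rightarrow> 'v \<Rightarrow> 'v option" where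
  "pick A v = (if v \<in> A then Some v else None)"

abbreviation choice :: "'v set \<Rightarrow> 'v sba_term \<Rightarrow> 'v option" where
  "choice A t \<equiv> eval choice_alg (pick A) t"

lemma choice_SomeD: "choice A t = Some v \<Longrightarrow> v \<in> A \<and> v \<in> vars t"
  by (induction t) (auto simp: pick_def split: if_splits)

context left_handed_sba
begin

text \<open>
  If any two nonzero values of \<open>\<rho>\<close> are equivalent, then \<open>Some v \<mapsto> \<rho> v\<close> and \<open>None \<mapsto> \<zero>\<close> respects
  the operations of \<open>choice_alg\<close> on the variables with nonzero value.
\<close>

lemma eval_decided:
  assumes \<rho>: "range \<rho> \<subseteq> carrier S"
    and dec: "\<And>u v. \<rho> v = \<zero> \<or> \<rho> u \<sqinter> \<rho> v = \<rho> u"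
  shows "eval S \<rho> t = (case choice {v. \<rho> v \<noteq> \<zero>} t of None \<Rightarrow> \<zero> | Some v \<Rightarrow> \<rho> v)"
proof -
  have c: "\<rho> v \<in> carrier S" for v using \<rho> by auto
  have m: "\<rho> u \<sqinter> \<rho> v = \<rho> u" if "\<rho> v \<noteq> \<zero>" for u v using dec that by blast
  have j: "\<rho> u \<squnion> \<rho> v = \<rho> v" if "\<rho> v \<noteq> \<zero>" for u v
    using m[OF that] meet_join_absorb_right[OF c c] by metis
  have d: "\<rho> u \<setminus> \<rho> v = \<zero>" if "\<rho> v \<noteq> \<zero>" for u v
    using m[OF that] by (simp add: diff_eq_zero c)
  define A where "A = {v. \<rho> v \<noteq> \<zero>}"
  have nz: "\<rho> v \<noteq> \<zero>" if "choice A t = Some v" for v t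
    using choice_SomeD[OF that] by (simp add: A_def)
  have "eval S \<rho> t = (case choice A t of None \<Rightarrow> \<zero> | Some v \<Rightarrow> \<rho> v)"
  proof (induction t)
    case (Meet s t)
    then show ?case
      by (cases "choice A s"; cases "choice A t") (auto simp: c m zero_meet meet_zero dest: nz)
  next
    case (Join s t)
    then show ?case
      by (cases "choice A s"; cases "choice A t") (auto simp: c j zero_join join_zero dest: nz)
  next
    case (Diff s t)
    then show ?case
      by (cases "choice A s"; cases "choice A t") (auto simp: c d zero_diff diff_zero dest: nz)
  qed (simp_all add: pick_def A_def)
  then show ?thesis by (simp add: A_def)
qed

text \<open>
  A variable \<open>v\<close> is decided by \<open>\<rho>\<close> if \<open>\<rho> v = \<zero>\<close> or every value of \<open>\<rho>\<close> lies under \<open>\<rho> v\<close> in the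
  sense \<open>\<rho> u \<sqinter> \<rho> v = \<rho> u\<close>. Endomorphisms preserve decidedness. With \<open>e = \<rho> y\<close>, the endomorphism
  \<open>w \<mapsto> w \<sqinter> e\<close> sends \<open>y\<close> to \<open>e\<close>, above all other new values, and \<open>w \<mapsto> w \<setminus> e\<close> sends it to
  \<open>\<zero>\<close>; either way \<open>y\<close> becomes decided, and an element is the join of its two images.
  The set \<open>Y\<close> contains the undecided variables. Restricting \<open>A\<close> to variables with nonzero value
  suits the induction, since endomorphisms can only shrink that set.
\<close>

lemma eval_eqI_choice:
  assumes "finite Y" "range \<rho> \<subseteq> carrier S"
    and "\<And>u v. v \<notin> Y \<Longrightarrow> \<rho> v = \<zero> \<or> \<rho> u \<sqinter> \<rho> v = \<rho> u"
    and eq: "\<And>A. A \<subseteq> {v. \<rho> v \<noteq> \<zero>} \<Longrightarrow> choice A s = choice A t"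
  shows "eval S \<rho> s = eval S \<rho> t"
  using assms
proof (induction Y arbitrary: \<rho> rule: finite_induct)
  case empty
  then show ?case by (simp add: eval_decided)
next
  case (insert y Y)
  let ?e = "\<rho> y"
  have c: "\<rho> v \<in> carrier S" for v using insert.prems(1) by auto
  have part: "h (eval S \<rho> s) = h (eval S \<rho> t)"
    if h: "h \<in> sba_hom S S" and y: "\<And>u. h ?e = \<zero> \<or> h (\<rho> u) \<sqinter> h ?e = h (\<rho> u)" for h
  proof -
    have hc: "h x \<in> carrier S" if "x \<in> carrier S" for x using h that by (auto simp: sba_hom_def)
    have h0: "h \<zero> = \<zero>" using h by (simp add: sba_hom_def)
    have hm: "h (x \<sqinter> z) = h x \<sqinter> h z" if "x \<in> carrier S" "z \<in> carrier S" for x z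
      using h that by (simp add: sba_hom_def)
    have "eval S (\<lambda>v. h (\<rho> v)) s = eval S (\<lambda>v. h (\<rho> v)) t"
    proof (rule insert.IH)
      show "range (\<lambda>v. h (\<rho> v)) \<subseteq> carrier S" using c hc by auto
      show "h (\<rho> v) = \<zero> \<or> h (\<rho> u) \<sqinter> h (\<rho> v) = h (\<rho> u)" if "v \<notin> Y" for u v
      proof (cases "v = y")
        case False
        then show ?thesis using insert.prems(2)[of v u] that h0 c by (metis hm insert_iff)
      qed (use y in simp)
      show "choice A s = choice A t" if "A \<subseteq> {v. h (\<rho> v) \<noteq> \<zero>}" for A
        using that h0 by (intro insert.prems(3)) auto
    qed
    then show ?thesis using c by (simp add: eval_hom[OF h closed] image_subset_iff)
  qed
  have ev: "eval S \<rho> t \<in> carrier S" for t by (rule eval_closed[OF closed]) (use c in auto)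
  have "eval S \<rho> s \<sqinter> ?e = eval S \<rho> t \<sqinter> ?e"
    by (rule part[OF meet_hom]) (simp_all add: c meet_idem meet_assoc)
  moreover have "eval S \<rho> s \<setminus> ?e = eval S \<rho> t \<setminus> ?e"
    by (rule part[OF diff_hom]) (simp_all add: c diff_eq_zero meet_idem)
  ultimately show ?case
    using join_diff_left[OF ev c] by metis
qed

end

lemma finite_vars: "finite (vars t)"
  by (induction t) auto


section \<open>Intersections as terms\<close>

text \<open>
  The recursion mirrors the operations of \<open>choice_alg\<close>: the value of a meet or a difference, where
  nonzero, is that of the left argument, and the value of a join is that of the right argument
  unless the latter is \<open>None\<close>. The result denotes the intersection of \<open>t\<close> with the generator \<open>v\<close>.
\<close>

primrec restrict_choice :: "'v \<Rightarrow> 'v sba_term \<Rightarrow> 'v sba_term" where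
  "restrict_choice v (Var u) = (if u = v then Var v else \<^bold>0)"
| "restrict_choice v \<^bold>0 = \<^bold>0"
| "restrict_choice v (s \<^bold>\<and> t) = restrict_choice v s \<^bold>\<and> t"
| "restrict_choice v (s \<^bold>\<or> t) = (restrict_choice v s \<^bold>\<setminus> t) \<^bold>\<or> restrict_choice v t"
| "restrict_choice v (s \<^bold>\<setminus> t) = restrict_choice v s \<^bold>\<setminus> t"

lemma choice_restrict_choice:
  "choice A (restrict_choice v t) = (if choice A t = Some v then Some v else None)"
  by (induction t) (simp_all add: pick_def)

lemma vars_restrict_choice: "vars (restrict_choice v t) \<subseteq> vars t"
  by (induction t) auto

text \<open>
  The part of \<open>s\<close> and \<open>t\<close> on which both choose the same variable, collected over the variables
  listed. For different variables the joinands are orthogonal, so the order of the list is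
  immaterial for the value.
\<close>

primrec agreement :: "'v list \<Rightarrow> 'v sba_term \<Rightarrow> 'v sba_term \<Rightarrow> 'v sba_term" where
  "agreement [] s t = \<^bold>0"
| "agreement (v # vs) s t = (restrict_choice v s \<^bold>\<and> restrict_choice v t) \<^bold>\<or> agreement vs s t"

lemma choice_agreement:
  "choice A (agreement vs s t) =
    (if choice A s = choice A t \<and> choice A s \<in> Some ` set vs then choice A s else None)"
proof (induction vs)
  case (Cons w vs)
  have "choice A (restrict_choice w s \<^bold>\<and> restrict_choice w t) =
      (if choice A s = Some w \<and> choice A t = Some w then Some w else None)"
    by (simp only: eval.simps choice_restrict_choice choice_alg_simps) simp
  then have "choice A (agreement (w # vs) s t) = (if choice A (agreement vs s t) = None
      then if choice A s = Some w \<and> choice A t = Some w then Some w else None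
      else choice A (agreement vs s t))"
    by simp
  then show ?case unfolding Cons by (cases "choice A s"; cases "choice A t") auto
qed simp

lemma vars_agreement: "vars (agreement vs s t) \<subseteq> vars s \<union> vars t"
proof (induction vs)
  case (Cons v vs)
  have "vars (agreement (v # vs) s t) =
      vars (restrict_choice v s) \<union> vars (restrict_choice v t) \<union> vars (agreement vs s t)"
    by simp
  then show ?case
    using Cons vars_restrict_choice[of v s] vars_restrict_choice[of v t] by blast
qed simp

lemma ex_intersection_term:
  "\<exists>u. vars u \<subseteq> vars s \<union> vars t \<and>
       (\<forall>A. choice A u = (if choice A s = choice A t then choice A s else None))"
proof -
  obtain vs where vs: "set vs = vars s" using finite_list[OF finite_vars[of s]] by blast
  have "choice A (agreement vs s t) = (if choice A s = choice A t then choice A s else None)" for A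
  proof (cases "choice A s")
    case (Some v)
    then have "choice A s \<in> Some ` set vs" using choice_SomeD[OF Some] by (simp add: vs)
    then show ?thesis by (simp add: choice_agreement)
  qed (simp add: choice_agreement)
  then show ?thesis using vars_agreement[of vs s t] by (intro exI[of _ "agreement vs s t"]) simp
qed


section \<open>Intersections in freely generated algebras\<close>

lemma is_intersection_iff:
  assumes "x \<in> carrier S" "y \<in> carrier S"
  shows "is_intersection S x y m \<longleftrightarrow>
    m \<in> carrier S \<and> m \<sqsubseteq>\<^bsub>natural_order S\<^esub> x \<and> m \<sqsubseteq>\<^bsub>natural_order S\<^esub> y \<and>
    (\<forall>z\<in>carrier S. z \<sqsubseteq>\<^bsub>natural_order S\<^esub> x \<longrightarrow> z \<sqsubseteq>\<^bsub>natural_order S\<^esub> y \<longrightarrow> z \<sqsubseteq>\<^bsub>natural_order S\<^esub> m)"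
  using assms
  by (auto simp: is_intersection_def greatest_def Lower_def natural_order_def)

lemma is_intersection_unique:
  assumes "x \<in> carrier S" "y \<in> carrier S" "is_intersection S x y m" "is_intersection S x y m'"
  shows "m = m'"
  using assms by (simp add: is_intersection_iff natural_order_def) metis

lemma is_intersection_opposite: "is_intersection (opposite S) = is_intersection S"
proof -
  have "natural_order (opposite S) = natural_order S"
    by (auto simp: natural_order_def)
  then show ?thesis by (simp add: is_intersection_def fun_eq_iff)
qed

lemma subalgebra_gen_meet [simp]:
  "x \<sqinter>\<^bsub>subalgebra_gen S G\<^esub> y = x \<sqinter>\<^bsub>S\<^esub> y"
  by (simp add: subalgebra_gen_def)

lemma carrier_subalgebra_gen:
  assumes S: "closed_under S (carrier S)" and g: "g ` Y \<subseteq> carrier S"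
  shows "carrier (subalgebra_gen S (g ` Y)) = eval S g ` {t. vars t \<subseteq> Y}"
proof -
  let ?B = "eval S g ` {t. vars t \<subseteq> Y}"
  have "eval S g t \<in> carrier S" if "vars t \<subseteq> Y" for t
    by (rule eval_closed[OF S]) (use g that in blast)
  then have 1: "?B \<subseteq> carrier S" by blast
  have img: "eval S g t \<in> ?B" if "vars t \<subseteq> Y" for t using that by blast
  have "eval S g s \<sqinter>\<^bsub>S\<^esub> eval S g t \<in> ?B \<and> eval S g s \<squnion>\<^bsub>S\<^esub> eval S g t \<in> ?B \<and>
      eval S g s \<setminus>\<^bsub>S\<^esub> eval S g t \<in> ?B" if "vars s \<subseteq> Y" "vars t \<subseteq> Y" for s t
    using that img[of "s \<^bold>\<and> t"] img[of "s \<^bold>\<or> t"] img[of "s \<^bold>\<setminus> t"] by simp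
  then have 2: "closed_under S ?B"
    using img[of "\<^bold>0"] by (auto simp: closed_under_def)
  have 3: "g ` Y \<subseteq> ?B" by (auto simp: image_iff intro!: exI[of _ "Var _"])
  have "eval S g t \<in> B" if "closed_under S B" "g ` Y \<subseteq> B" "vars t \<subseteq> Y" for t B
    using that by (induction t) (auto simp: closed_under_def)
  with 1 2 3 show ?thesis by (auto simp: subalgebra_gen_def)
qed

text \<open>
  The two properties of free algebras from which intersections are obtained: they are generated by
  the variables, and they have enough homomorphisms to \<open>choice_alg\<close>. The opposite of a free
  right-handed algebra has them as well, although it is not itself presented as a free algebra.
\<close>

locale choice_free_sba = left_handed_sba +
  fixes X :: "'v set" and g :: "'v \<Rightarrow> 'a"
  assumes gen_closed: "g ` X \<subseteq> carrier S"
    and generated: "carrier S = carrier (subalgebra_gen S (g ` X))"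
    and choice_hom: "\<And>A. \<exists>h\<in>sba_hom S choice_alg. \<forall>v\<in>X. h (g v) = pick A v"
begin

text \<open>
  The evaluation in \<open>S\<close> determines the choices through the homomorphisms to \<open>choice_alg\<close>;
  conversely, the choices determine the evaluation by splitting along the variables that occur.
\<close>

lemma eval_gen_eq_iff:
  assumes "vars s \<subseteq> X" "vars t \<subseteq> X"
  shows "eval S g s = eval S g t \<longleftrightarrow> (\<forall>A. choice A s = choice A t)"
proof
  assume eq: "eval S g s = eval S g t"
  show "\<forall>A. choice A s = choice A t"
  proof
    fix A
    obtain h where h: "h \<in> sba_hom S choice_alg" "\<And>v. v \<in> X \<Longrightarrow> h (g v) = pick A v"
      using choice_hom by blast
    have "h (eval S g r) = choice A r" if "vars r \<subseteq> X" for r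
    proof -
      have "g ` vars r \<subseteq> carrier S" using gen_closed that by blast
      then have "h (eval S g r) = eval choice_alg (\<lambda>v. h (g v)) r" by (rule eval_hom[OF h(1) closed])
      also have "\<dots> = choice A r" using h(2) that by (intro eval_cong_vars) blast
      finally show ?thesis .
    qed
    then show "choice A s = choice A t" using assms eq by metis
  qed
next
  assume eq: "\<forall>A. choice A s = choice A t"
  define Y where "Y = vars s \<union> vars t"
  \<comment> \<open>The value \<open>\<zero>\<close> makes every variable outside \<open>Y\<close> decided, so finitely many splits suffice.\<close>
  define \<rho> where "\<rho> v = (if v \<in> Y then g v else \<zero>)" for v
  have "eval S \<rho> s = eval S \<rho> t"
  proof (rule eval_eqI_choice)
    show "finite Y" by (simp add: Y_def finite_vars)
    show "range \<rho> \<subseteq> carrier S" using assms gen_closed by (auto simp: \<rho>_def Y_def)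
    show "\<rho> v = \<zero> \<or> \<rho> u \<sqinter> \<rho> v = \<rho> u" if "v \<notin> Y" for u v using that by (simp add: \<rho>_def)
  qed (use eq in blast)
  moreover have "eval S \<rho> s = eval S g s" "eval S \<rho> t = eval S g t"
    by (rule eval_cong_vars; simp add: \<rho>_def Y_def)+
  ultimately show "eval S g s = eval S g t" by simp
qed

lemma natural_order_eval_iff:
  assumes "vars s \<subseteq> X" "vars t \<subseteq> X"
  shows "eval S g s \<sqsubseteq>\<^bsub>natural_order S\<^esub> eval S g t \<longleftrightarrow>
    (\<forall>A. choice A s = None \<or> choice A s = choice A t)"
proof -
  have "eval S g s \<sqsubseteq>\<^bsub>natural_order S\<^esub> eval S g t \<longleftrightarrow>
      (\<forall>A. choice A (t \<^bold>\<and> s) = choice A s) \<and> (\<forall>A. choice A (s \<^bold>\<and> t) = choice A s)"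
    using eval_gen_eq_iff[of "t \<^bold>\<and> s" s] eval_gen_eq_iff[of "s \<^bold>\<and> t" s] assms
    by (simp add: natural_order_def)
  moreover have "choice A (t \<^bold>\<and> s) = choice A s \<and> choice A (s \<^bold>\<and> t) = choice A s \<longleftrightarrow>
      choice A s = None \<or> choice A s = choice A t" for A
    by (cases "choice A s"; cases "choice A t") auto
  ultimately show ?thesis by blast
qed

text \<open>
  The intersection term of two terms over \<open>Y\<close> is again a term over \<open>Y\<close>, while the order is
  computed pointwise from choices independently of \<open>Y\<close>. So one element serves in both algebras.
\<close>

lemma ex_common_intersection:
  assumes Y: "Y \<subseteq> X"
    and x: "x \<in> carrier (subalgebra_gen S (g ` Y))" and y: "y \<in> carrier (subalgebra_gen S (g ` Y))"
  shows "\<exists>m. is_intersection (subalgebra_gen S (g ` Y)) x y m \<and> is_intersection S x y m"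
proof -
  let ?T = "subalgebra_gen S (g ` Y)"
  have T: "carrier ?T = eval S g ` {t. vars t \<subseteq> Y}"
    using Y gen_closed by (intro carrier_subalgebra_gen closed) blast
  have SX: "carrier S = eval S g ` {t. vars t \<subseteq> X}"
    using generated gen_closed by (simp add: carrier_subalgebra_gen closed)
  obtain s t where s: "x = eval S g s" "vars s \<subseteq> Y" and t: "y = eval S g t" "vars t \<subseteq> Y"
    using x y T by auto
  obtain u where u: "vars u \<subseteq> vars s \<union> vars t"
    "\<And>A. choice A u = (if choice A s = choice A t then choice A s else None)"
    using ex_intersection_term[of s t] by blast
  have uY: "vars u \<subseteq> Y" using u(1) s(2) t(2) by blast
  have X: "vars s \<subseteq> X" "vars t \<subseteq> X" "vars u \<subseteq> X" using s(2) t(2) uY Y by blast+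
  let ?m = "eval S g u"
  have lower: "?m \<sqsubseteq>\<^bsub>natural_order S\<^esub> x" "?m \<sqsubseteq>\<^bsub>natural_order S\<^esub> y"
    using X by (simp_all add: s(1) t(1) natural_order_eval_iff u(2))
  have greatest: "z \<sqsubseteq>\<^bsub>natural_order S\<^esub> ?m"
    if z: "z \<in> carrier S" "z \<sqsubseteq>\<^bsub>natural_order S\<^esub> x" "z \<sqsubseteq>\<^bsub>natural_order S\<^esub> y" for z
  proof -
    obtain r where r: "z = eval S g r" "vars r \<subseteq> X" using z(1) SX by auto
    show ?thesis using z(2,3) X r(2) by (simp add: r(1) s(1) t(1) natural_order_eval_iff u(2)) metis
  qed
  have TS: "carrier ?T \<subseteq> carrier S" using T SX Y by blast
  have ord: "z \<sqsubseteq>\<^bsub>natural_order ?T\<^esub> w \<longleftrightarrow> z \<sqsubseteq>\<^bsub>natural_order S\<^esub> w" for z w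
    by (simp add: natural_order_def)
  have mT: "?m \<in> carrier ?T" using uY T by blast
  have "is_intersection ?T x y ?m"
    using x y mT lower greatest TS by (auto simp: is_intersection_iff ord)
  moreover have "is_intersection S x y ?m"
    using x y mT lower greatest TS by (auto simp: is_intersection_iff subset_iff)
  ultimately show ?thesis by blast
qed

lemma has_intersections: "has_intersections S"
  unfolding has_intersections_def using ex_common_intersection[OF order_refl, folded generated] by blast

lemma intersection_in_subalgebra:
  assumes Y: "Y \<subseteq> X"
    and x: "x \<in> carrier (subalgebra_gen S (g ` Y))" and y: "y \<in> carrier (subalgebra_gen S (g ` Y))"
  shows "\<exists>m. is_intersection (subalgebra_gen S (g ` Y)) x y m"
    and "is_intersection (subalgebra_gen S (g ` Y)) x y m \<Longrightarrow> is_intersection S x y m"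
  using ex_common_intersection[OF assms] is_intersection_unique[OF x y] by blast+

end


section \<open>The free algebras\<close>

lemma free_gen_closed: "free_gen E X ` X \<subseteq> carrier (free_alg E X)"
  by (auto simp: free_gen_def free_alg_carrier)

lemma free_alg_generated:
  "carrier (free_alg E X) = carrier (subalgebra_gen (free_alg E X) (free_gen E X ` X))"
proof -
  have eval_gen: "eval (free_alg E X) (free_gen E X) t = term_cong E X `` {t}" if "vars t \<subseteq> X" for t
    using that by (induction t) (simp_all add: free_gen_def free_alg_zero free_alg_ops)
  have closed: "closed_under (free_alg E X) (carrier (free_alg E X))"
    using free_alg_in_variety[of E X] unfolding in_variety_def by blast
  have "carrier (subalgebra_gen (free_alg E X) (free_gen E X ` X)) =
      eval (free_alg E X) (free_gen E X) ` {t. vars t \<subseteq> X}"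
    by (rule carrier_subalgebra_gen[OF closed free_gen_closed])
  also have "\<dots> = carrier (free_alg E X)"
    unfolding free_alg_carrier by (rule image_cong) (simp_all add: eval_gen)
  finally show ?thesis by simp
qed

lemma choice_free_left:
  "choice_free_sba (left_SBA X) X (free_gen left_sba_ids X)"
proof -
  have "left_handed_sba (left_SBA X)"
    using free_alg_in_variety by (simp add: left_SBA_def flip: in_variety_left_iff)
  then interpret left_handed_sba "left_SBA X" .
  show ?thesis
  proof
    show "free_gen left_sba_ids X ` X \<subseteq> carrier (left_SBA X)"
      unfolding left_SBA_def by (rule free_gen_closed)
    show "carrier (left_SBA X) = carrier (subalgebra_gen (left_SBA X) (free_gen left_sba_ids X ` X))"
      unfolding left_SBA_def by (rule free_alg_generated)
    fix A :: "'a set"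
    show "\<exists>h\<in>sba_hom (left_SBA X) choice_alg. \<forall>v\<in>X. h (free_gen left_sba_ids X v) = pick A v"
      unfolding left_SBA_def
      by (rule free_alg_universal) (simp_all add: in_variety_left_iff left_handed_choice_alg)
  qed
qed

lemma choice_free_right:
  "choice_free_sba (opposite (right_SBA X)) X (free_gen right_sba_ids X)"
proof -
  have "right_handed_sba (right_SBA X)"
    using free_alg_in_variety by (simp add: right_SBA_def flip: in_variety_right_iff)
  then interpret left_handed_sba "opposite (right_SBA X)" by (rule left_handed_opposite)
  show ?thesis
  proof
    show "free_gen right_sba_ids X ` X \<subseteq> carrier (opposite (right_SBA X))"
      unfolding right_SBA_def using free_gen_closed by simp
    show "carrier (opposite (right_SBA X)) =
        carrier (subalgebra_gen (opposite (right_SBA X)) (free_gen right_sba_ids X ` X))"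
      unfolding right_SBA_def subalgebra_gen_opposite using free_alg_generated by simp
    fix A :: "'a set"
    have "\<exists>h\<in>sba_hom (right_SBA X) (opposite choice_alg).
        \<forall>v\<in>X. h (free_gen right_sba_ids X v) = pick A v"
      unfolding right_SBA_def
      by (rule free_alg_universal)
        (simp_all add: in_variety_right_iff right_handed_opposite left_handed_choice_alg)
    then show "\<exists>h\<in>sba_hom (opposite (right_SBA X)) choice_alg.
        \<forall>v\<in>X. h (free_gen right_sba_ids X v) = pick A v" by (simp add: sba_hom_opposite)
  qed
qed

theorem theorem6p4:
  fixes X :: "'v set"
  shows "has_intersections (left_SBA X) \<and> has_intersections (right_SBA X) \<and>
    (\<forall>x\<in>carrier (left_SBA X). \<forall>y\<in>carrier (left_SBA X). \<forall>Y\<subseteq>X.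
       finite Y \<and> x \<in> carrier (left_SBA_sub X Y) \<and> y \<in> carrier (left_SBA_sub X Y) \<longrightarrow>
       (\<exists>m. is_intersection (left_SBA_sub X Y) x y m) \<and>
       (\<forall>m. is_intersection (left_SBA_sub X Y) x y m \<longrightarrow> is_intersection (left_SBA X) x y m)) \<and>
    (\<forall>x\<in>carrier (right_SBA X). \<forall>y\<in>carrier (right_SBA X). \<forall>Y\<subseteq>X.
       finite Y \<and> x \<in> carrier (right_SBA_sub X Y) \<and> y \<in> carrier (right_SBA_sub X Y) \<longrightarrow>
       (\<exists>m. is_intersection (right_SBA_sub X Y) x y m) \<and>
       (\<forall>m. is_intersection (right_SBA_sub X Y) x y m \<longrightarrow> is_intersection (right_SBA X) x y m))"
proof -
  interpret L: choice_free_sba "left_SBA X" X "free_gen left_sba_ids X" by (rule choice_free_left)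
  interpret R: choice_free_sba "opposite (right_SBA X)" X "free_gen right_sba_ids X"
    by (rule choice_free_right)
  note R' = R.intersection_in_subalgebra
    [unfolded subalgebra_gen_opposite is_intersection_opposite opposite_simps]
  have "has_intersections (right_SBA X)"
    using R.has_intersections by (simp add: has_intersections_def is_intersection_opposite)
  then show ?thesis
    unfolding left_SBA_sub_def right_SBA_sub_def
    by (intro conjI ballI allI impI; (elim conjE)?)
      (rule L.has_intersections L.intersection_in_subalgebra R' | assumption)+
qed

end
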